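(* The family $\mathcal{V}=\{T\in\mathrm{Tree}_2 : T\text{ contains (as a subset) a Silver tree}\}$ is a $\mathbf{\Sigma}_1^1$-complete subset of $\mathrm{Tree}_2$.
   Context: A tree over $\{0,1\}$ is a set $T\subseteq 2^{<\omega}$ (finite $0$-$1$ sequences) closed under initial segments. $\mathrm{Tree}_2$ is the set of all such trees, a Polish space as a subspace of $\mathcal{P}(2^{<\omega})\cong 2^{2^{<\omega}}$ (product topology). A tree $T\in\mathrm{Tree}_2$ is a Silver tree if there exist a set $A\subseteq\omega$ with $\omega\setminus A$ infinite and a function $x:\omega\to 2$ such that $T=\{\sigma\in 2^{<\omega} : (\forall n\in A \text{ with } n<|\sigma|)\ \sigma(n)=x(n)\}$. Completeness: for Polish spaces $\mathcal{X},\mathcal{Y}$ and $A\subseteq\mathcal{X}$, $B\subseteq\mathcal{Y}$, $B$ is Borel reducible to $A$ if there is a Borel function $f:\mathcal{Y}\to\mathcal{X}$ with $f^{-1}[A]=B$. $A\subseteq\mathcal{X}$ is $\mathbf{\Sigma}_1^1$-complete if $A$ is analytic and for every Polish space $\mathcal{Y}$ every analytic $B\subseteq\mathcal{Y}$ is Borel reducible to $A$. *)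

theory Defs
  imports "HOL-Analysis.Analysis" "HOL-Library.Sublist"
begin

definition Polish_top :: "'a topology \<Rightarrow> bool" where
  "Polish_top X \<longleftrightarrow> completely_metrizable_space X \<and> separable_space X"

definition Borel_map :: "'a topology \<Rightarrow> 'b topology \<Rightarrow> ('a \<Rightarrow> 'b) \<Rightarrow> bool" where
  "Borel_map X Y f \<longleftrightarrow>
     f \<in> sigma (topspace X) {U. openin X U} \<rightarrow>\<^sub>M sigma (topspace Y) {U. openin Y U}"

definition Baire_space :: "(nat \<Rightarrow> nat) topology" where
  "Baire_space = product_topology (\<lambda>_. discrete_topology UNIV) UNIV"

text \<open>The empty set is listed separately, since it is not an image of the (nonempty) Baire space.\<close>

definition analytic_in :: "'a topology \<Rightarrow> 'a set \<Rightarrow> bool" where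
  "analytic_in X A \<longleftrightarrow>
     A = {} \<or> (\<exists>f. continuous_map Baire_space X f \<and> f ` topspace Baire_space = A)"

definition Borel_reducible :: "'b topology \<Rightarrow> 'b set \<Rightarrow> 'a topology \<Rightarrow> 'a set \<Rightarrow> bool" where
  "Borel_reducible Y B X A \<longleftrightarrow> (\<exists>f. Borel_map Y X f \<and> {y \<in> topspace Y. f y \<in> A} = B)"

text \<open>A definition cannot quantify over types, so the type carrying the Polish spaces to be reduced
  is a parameter. A statement that leaves \<open>'b\<close> a free type variable covers Polish spaces over
  arbitrary types.\<close>

definition Sigma11_complete :: "'b itself \<Rightarrow> 'a topology \<Rightarrow> 'a set \<Rightarrow> bool" where
  "Sigma11_complete (_ :: 'b itself) X A \<longleftrightarrow>
     Polish_top X \<and> analytic_in X A \<and>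
     (\<forall>(Y :: 'b topology) B. Polish_top Y \<and> analytic_in Y B \<longrightarrow> Borel_reducible Y B X A)"

text \<open>Finite 0-1 sequences are lists of Booleans, with \<open>True\<close> standing for 1.\<close>

definition is_tree :: "bool list set \<Rightarrow> bool" where
  "is_tree T \<longleftrightarrow> (\<forall>\<sigma>\<in>T. \<forall>\<tau>. prefix \<tau> \<sigma> \<longrightarrow> \<tau> \<in> T)"

text \<open>The topology on the power set that makes the bijection sending a set to its indicator
  function a homeomorphism onto the product of discrete two-point spaces.\<close>

definition powerset_top :: "'a set topology" where
  "powerset_top =
     pullback_topology UNIV (\<lambda>S a. a \<in> S)
       (product_topology (\<lambda>_. discrete_topology (UNIV :: bool set)) UNIV)"

definition Tree2 :: "bool list set topology" where
  "Tree2 = subtopology powerset_top {T. is_tree T}"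

definition Silver_tree :: "bool list set \<Rightarrow> bool" where
  "Silver_tree T \<longleftrightarrow> is_tree T \<and>
     (\<exists>(A :: nat set) (x :: nat \<Rightarrow> bool). infinite (UNIV - A) \<and>
        T = {\<sigma>. \<forall>n\<in>A. n < length \<sigma> \<longrightarrow> \<sigma> ! n = x n})"

end

theory Submission
  imports Defs
begin

text \<open>
  Hardness. Let \<open>B = g[\<omega>\<^sup>\<omega>]\<close> be analytic in \<open>Y\<close>. Read a finite 0-1 sequence \<open>\<sigma>\<close> as the increasing list
  \<open>t\<^sub>0 < \<dots> < t\<^sub>k\<close> of positions of its ones, let \<open>M\<^sub>\<sigma>\<close> be the set of all \<open>z\<close> with \<open>z\<^sub>i \<le> t\<^sub>i\<close> for \<open>i \<le> k\<close>,
  and map \<open>y\<close> to the tree of all \<open>\<sigma>\<close> with \<open>y\<close> in the closure of \<open>g[M\<^sub>\<sigma>]\<close>. If \<open>y = g(z)\<close>, choose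
  \<open>d\<^sub>0 < d\<^sub>1 < \<dots>\<close> with \<open>z\<^sub>i \<le> d\<^sub>i\<close>: dropping elements of \<open>d\<close> only weakens the bounds, so the tree
  contains every \<open>\<sigma>\<close> whose ones lie in \<open>d\<close>, which is a Silver tree. Conversely, a Silver subtree has
  a branch with infinitely many ones, at positions \<open>t\<^sub>0 < t\<^sub>1 < \<dots>\<close>. The sets \<open>{z. z\<^sub>i \<le> t\<^sub>i for i < n}\<close>
  shrink to the compact set of all \<open>z \<le> t\<close> and are eventually inside each of its neighbourhoods,
  so \<open>y = g(z)\<close> for some \<open>z \<le> t\<close>. Membership of a fixed \<open>\<sigma>\<close> is a closed condition on \<open>y\<close>, so the
  map is Borel.

  Analyticity. A sequence of naturals codes an infinite set of free positions, a function \<open>x\<close> and an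
  arbitrary subtree, and is sent to the union of the Silver tree with that subtree.
\<close>

section \<open>Cylinders and compact boxes in function spaces\<close>

lemma open_cylinder:
  fixes f :: "'a \<Rightarrow> 'b::discrete_topology"
  assumes "finite I"
  shows "open {g. \<forall>i\<in>I. g i = f i}"
proof -
  have "{g. \<forall>i\<in>I. g i = f i} = (\<Inter>i\<in>I. (\<lambda>g. g i) -` {f i})"
    by auto
  moreover have "open ((\<lambda>g::'a \<Rightarrow> 'b. g i) -` {f i})" for i
    by (intro open_vimage open_discrete continuous_on_product_coordinates)
  ultimately show ?thesis
    using assms by auto
qed

text \<open>Every preimage under \<open>h\<close> is a union of cylinders over \<open>I\<close>,
  whatever the topology on the target.\<close>

lemma continuous_on_finite_support:
  fixes h :: "('a \<Rightarrow> 'b::discrete_topology) \<Rightarrow> 'c::topological_space"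
  assumes "finite I" and h: "\<And>f g. (\<forall>i\<in>I. g i = f i) \<Longrightarrow> h g = h f"
  shows "continuous_on UNIV h"
proof -
  have "open (h -` U)" for U
  proof (subst open_subopen, clarify)
    fix f assume "h f \<in> U"
    then have "{g. \<forall>i\<in>I. g i = f i} \<subseteq> h -` U"
      using h by force
    then show "\<exists>T. open T \<and> f \<in> T \<and> T \<subseteq> h -` U"
      using open_cylinder[OF \<open>finite I\<close>, of f] by blast
  qed
  then show ?thesis
    by (simp add: continuous_on_open_vimage)
qed

text \<open>A basic open box restricts only finitely many coordinates, and these all lie below some
  \<open>k\<close>.\<close>

lemma cylinder_in_open:
  fixes z :: "nat \<Rightarrow> 'b::topological_space"
  assumes "open V" "z \<in> V"
  obtains k where "{w. \<forall>i<k. w i = z i} \<subseteq> V"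
proof -
  have "openin (product_topology (\<lambda>_. euclidean) UNIV) V"
    using assms by (simp add: euclidean_product_topology)
  then obtain X where X: "z \<in> Pi\<^sub>E UNIV X" "finite {i. X i \<noteq> UNIV}" "Pi\<^sub>E UNIV X \<subseteq> V"
    using product_topology_open_contains_basis[of "\<lambda>_. euclidean" UNIV V z] \<open>z \<in> V\<close> by auto
  then obtain k where "{i. X i \<noteq> UNIV} \<subseteq> {..<k}"
    using finite_nat_bounded by blast
  then have "w i \<in> X i" if "\<forall>i<k. w i = z i" for w i
    using X(1) that by (cases "i < k") (auto simp: PiE_UNIV_domain)
  then have "{w. \<forall>i<k. w i = z i} \<subseteq> V"
    using X(3) by (auto simp: PiE_UNIV_domain)
  then show ?thesis ..
qed

lemma compact_bounded_functions:
  fixes t :: "nat \<Rightarrow> nat"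
  shows "compact {z. \<forall>i. z i \<le> t i}"
proof -
  have "{z. \<forall>i. z i \<le> t i} = Pi\<^sub>E UNIV (\<lambda>i. {..t i})"
    by (auto simp: PiE_UNIV_domain)
  moreover have "compactin (product_topology (\<lambda>_. euclidean) UNIV) (Pi\<^sub>E UNIV (\<lambda>i. {..t i}))"
    by (simp add: compactin_PiE finite_imp_compact)
  ultimately show ?thesis
    by (simp add: euclidean_product_topology)
qed

text \<open>By compactness finitely many cylinders inside \<open>V\<close> cover the box, and
  together they inspect only the coordinates below some \<open>n\<close>.\<close>

lemma bounded_functions_tube:
  fixes t :: "nat \<Rightarrow> nat"
  assumes "open V" and sub: "{z. \<forall>i. z i \<le> t i} \<subseteq> V"
  obtains n where "{z. \<forall>i<n. z i \<le> t i} \<subseteq> V"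
proof -
  let ?K = "{z. \<forall>i. z i \<le> t i}"
  define C :: "(nat \<Rightarrow> nat) \<Rightarrow> nat \<Rightarrow> (nat \<Rightarrow> nat) set" where "C z k = {w. \<forall>i<k. w i = z i}" for z k
  have "\<exists>k. C z k \<subseteq> V" if "z \<in> ?K" for z
    using cylinder_in_open[OF \<open>open V\<close> subsetD[OF sub that]] unfolding C_def by blast
  then have "\<exists>k. \<forall>z\<in>?K. C z (k z) \<subseteq> V"
    by (intro bchoice ballI)
  then obtain k where k: "\<And>z. z \<in> ?K \<Longrightarrow> C z (k z) \<subseteq> V"
    by blast
  have "open (C z (k z))" for z
    unfolding C_def using open_cylinder[of "{..<k z}" z] by (simp add: Ball_def)
  moreover have "?K \<subseteq> (\<Union>z\<in>?K. C z (k z))"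
    unfolding C_def by blast
  ultimately obtain Z where Z: "Z \<subseteq> ?K" "finite Z" "?K \<subseteq> (\<Union>z\<in>Z. C z (k z))"
    by (rule compactE_image[OF compact_bounded_functions])
  obtain n where n: "\<And>z. z \<in> Z \<Longrightarrow> k z \<le> n"
    using finite_nat_set_iff_bounded_le[of "k ` Z"] \<open>finite Z\<close> by auto
  have "w \<in> V" if w: "\<forall>i<n. w i \<le> t i" for w
  proof -
    \<comment> \<open>Cutting \<open>w\<close> off to 0 from \<open>n\<close> on respects all
      bounds, and no chosen cylinder sees the change, since each has length at most
      \<open>n\<close>.\<close>
    have "(\<lambda>i. if i < n then w i else 0) \<in> ?K"
      using w by simp
    then have "(\<lambda>i. if i < n then w i else 0) \<in> (\<Union>z\<in>Z. C z (k z))"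
      by (rule subsetD[OF Z(3)])
    then obtain z where z: "z \<in> Z" "(\<lambda>i. if i < n then w i else 0) \<in> C z (k z)"
      by (rule UN_E)
    then have "w \<in> C z (k z)"
      using n[OF z(1)] by (fastforce simp: C_def)
    then show ?thesis
      using k z(1) Z(1) by blast
  qed
  then show ?thesis
    using that by blast
qed

text \<open>Otherwise disjoint open sets separate \<open>y\<close> from the compact image of the
  box. The tube lemma puts the image of some finite stage inside the second set, so the first is a
  neighbourhood of \<open>y\<close> missing it.\<close>

lemma mem_image_bounded_functions:
  fixes t :: "nat \<Rightarrow> nat"
  assumes "Hausdorff_space Y" and g: "continuous_map euclidean Y g"
    and y: "\<And>n. y \<in> Y closure_of (g ` {z. \<forall>i<n. z i \<le> t i})"
  shows "y \<in> g ` {z. \<forall>i. z i \<le> t i}"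
proof (rule ccontr)
  let ?K = "{z. \<forall>i. z i \<le> t i}"
  assume "y \<notin> g ` ?K"
  moreover have "compactin Y (g ` ?K)"
    using image_compactin[OF _ g] compact_bounded_functions[of t] by simp
  moreover have "y \<in> topspace Y"
    using y[of 0] by (simp add: in_closure_of)
  ultimately have "compactin Y {y}" "compactin Y (g ` ?K)" "disjnt {y} (g ` ?K)"
    by auto
  then obtain U W where UW: "openin Y U" "openin Y W" "{y} \<subseteq> U" "g ` ?K \<subseteq> W" "disjnt U W"
    by (rule Hausdorff_space_compact_separation[OF \<open>Hausdorff_space Y\<close>])
  have "open (g -` W)"
    using g UW(2) by (simp add: continuous_map_alt)
  moreover have "?K \<subseteq> g -` W"
    using UW(4) by blast
  ultimately obtain n where "{z. \<forall>i<n. z i \<le> t i} \<subseteq> g -` W"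
    by (rule bounded_functions_tube)
  moreover obtain x where "x \<in> g ` {z. \<forall>i<n. z i \<le> t i}" "x \<in> U"
    using y[of n] UW(1,3) unfolding in_closure_of by blast
  ultimately show False
    using UW(5) by (auto simp: disjnt_def)
qed

section \<open>The Polish space of trees and maps into it\<close>

lemma Baire_space_eq: "Baire_space = euclidean"
proof -
  have "discrete_topology UNIV = (euclidean :: nat topology)"
    by (simp add: topology_eq open_discrete)
  then show ?thesis
    by (simp add: Baire_space_def euclidean_product_topology)
qed

lemma powerset_top_eq: "powerset_top = pullback_topology UNIV (\<lambda>S a. a \<in> S) euclidean"
proof -
  have "discrete_topology UNIV = (euclidean :: bool topology)"
    by (simp add: topology_eq open_discrete)
  then show ?thesis
    by (simp add: powerset_top_def euclidean_product_topology)
qed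

lemma topspace_Tree2: "topspace Tree2 = {T. is_tree T}"
  by (simp add: Tree2_def powerset_top_eq topspace_pullback_topology)

lemma openin_Tree2:
  "openin Tree2 U \<longleftrightarrow> (\<exists>W. open W \<and> U = {T. is_tree T \<and> (\<lambda>\<sigma>. \<sigma> \<in> T) \<in> W})"
  unfolding Tree2_def powerset_top_eq openin_subtopology openin_pullback_topology
  by (auto simp: vimage_def Int_def conj_commute)

lemma homeomorphic_Tree2: "Tree2 homeomorphic_space top_of_set {f. is_tree {\<sigma>. f \<sigma>}}"
proof -
  have "homeomorphic_maps Tree2 (top_of_set {f. is_tree {\<sigma>. f \<sigma>}}) (\<lambda>T \<sigma>. \<sigma> \<in> T) Collect"
    unfolding homeomorphic_maps_def continuous_map_alt topspace_Tree2
    by (auto simp: openin_Tree2 openin_open vimage_def Int_def conj_commute)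
  then show ?thesis
    by (auto simp: homeomorphic_space_def)
qed

text \<open>Each single instance of closure under prefixes is a clopen condition on two
  coordinates.\<close>

lemma closed_trees: "closed {f :: bool list \<Rightarrow> bool. is_tree {\<sigma>. f \<sigma>}}"
proof -
  have "{f. is_tree {\<sigma>. f \<sigma>}} = (\<Inter>\<sigma>. \<Inter>\<tau>\<in>{\<tau>. prefix \<tau> \<sigma>}. (\<lambda>f. f \<sigma> \<longrightarrow> f \<tau>) -` {True})"
    by (auto simp: is_tree_def)
  moreover have "closed ((\<lambda>f. f \<sigma> \<longrightarrow> f \<tau>) -` {True})" for \<sigma> \<tau> :: "bool list"
    by (intro closed_vimage continuous_on_finite_support[of "{\<sigma>, \<tau>}"]) auto
  ultimately show ?thesis
    by (simp add: closed_INT)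
qed

text \<open>Makes \<open>bool list \<Rightarrow> bool\<close> second countable and allows Borel
  measurability to be tested coordinatewise.\<close>

instance bool :: second_countable_topology
proof
  have "open = generate_topology (UNIV :: bool set set)"
    by (auto simp: fun_eq_iff open_discrete intro: generate_topology.Basis)
  then show "\<exists>\<B> :: bool set set. countable \<B> \<and> open = generate_topology \<B>"
    by (intro exI[of _ UNIV]) (simp add: countable_finite)
qed

lemma second_countable_euclidean:
  "second_countable (euclidean :: 'a::second_countable_topology topology)"
proof -
  obtain \<B> :: "'a set set" where "countable \<B>" "topological_basis \<B>"
    using ex_countable_basis by blast
  then show ?thesis
    unfolding second_countable_def
    by (metis open_openin topological_basis_open topological_basisE)
qed

lemma Polish_top_Tree2: "Polish_top Tree2"
proof -
  have discrete: "discrete_topology UNIV = (euclidean :: bool topology)"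
    by (simp add: topology_eq open_discrete)
  have "completely_metrizable_space (product_topology (\<lambda>_::bool list. discrete_topology (UNIV :: bool set)) UNIV)"
    by (simp add: completely_metrizable_space_product_topology completely_metrizable_space_discrete_topology)
  then have "completely_metrizable_space (euclidean :: (bool list \<Rightarrow> bool) topology)"
    by (simp add: discrete euclidean_product_topology)
  then have "completely_metrizable_space (top_of_set {f. is_tree {\<sigma>. f \<sigma>}})"
    using closed_trees by (simp add: completely_metrizable_space_closedin)
  moreover have "separable_space (top_of_set {f. is_tree {\<sigma>. f \<sigma>}})"
    by (intro second_countable_imp_separable_space second_countable_subtopology second_countable_euclidean)
  ultimately show ?thesis
    unfolding Polish_top_def
    using homeomorphic_Tree2 homeomorphic_completely_metrizable_space homeomorphic_separable_space
    by blast
qed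

lemma continuous_map_into_Tree2:
  assumes "\<And>x. is_tree (G x)" "\<And>\<sigma>. continuous_on UNIV (\<lambda>x. \<sigma> \<in> G x)"
  shows "continuous_map euclidean Tree2 G"
proof -
  have "continuous_on UNIV (\<lambda>x \<sigma>. \<sigma> \<in> G x)"
    using assms(2) by (rule continuous_on_coordinatewise_then_product)
  then show ?thesis
    using assms(1)
    by (auto simp: continuous_map_alt topspace_Tree2 openin_Tree2 continuous_on_open_vimage vimage_def)
qed

text \<open>The coordinates are indicators of closed sets; there are countably many, so they combine
  to a measurable map into the product.\<close>

lemma Borel_map_into_Tree2:
  assumes tree: "\<And>y. y \<in> topspace Y \<Longrightarrow> is_tree (F y)"
    and closed: "\<And>\<sigma>. closedin Y {y \<in> topspace Y. \<sigma> \<in> F y}"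
  shows "Borel_map Y Tree2 F"
proof -
  let ?M = "sigma (topspace Y) {U. openin Y U}"
  have sub: "{U. openin Z U} \<subseteq> Pow (topspace Z)" for Z :: "'c topology"
    by (auto dest: openin_subset)
  have space: "space ?M = topspace Y"
    using sub by (rule space_measure_of)
  have "(\<lambda>y. \<sigma> \<in> F y) \<in> borel_measurable ?M" for \<sigma>
  proof -
    \<comment> \<open>The generators are open sets, so the complement is treated first and then
      negated.\<close>
    have "topspace Y - {y \<in> topspace Y. \<sigma> \<in> F y} \<in> sets ?M"
      using closed[of \<sigma>] sub[of Y] by (auto simp: closedin_def intro!: sigma_sets.Basic)
    then have "{y \<in> topspace Y. \<sigma> \<notin> F y} \<in> sets ?M"
      by (simp add: set_diff_eq conj_commute cong: conj_cong)
    then have "Measurable.pred ?M (\<lambda>y. \<sigma> \<notin> F y)"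
      by (simp add: pred_def space)
    then have "Measurable.pred ?M (\<lambda>y. \<not> \<sigma> \<notin> F y)"
      by (rule pred_intros_logic)
    then have "(\<lambda>y. \<sigma> \<in> F y) \<in> ?M \<rightarrow>\<^sub>M count_space UNIV"
      by simp
    moreover have "(\<lambda>b. b) \<in> count_space UNIV \<rightarrow>\<^sub>M (borel :: bool measure)"
      by simp
    ultimately show ?thesis
      by (rule measurable_compose)
  qed
  then have meas: "(\<lambda>y \<sigma>. \<sigma> \<in> F y) \<in> borel_measurable ?M"
    by (rule measurable_coordinatewise_then_product)
  have "F -` U \<inter> space ?M \<in> sets ?M" if U: "openin Tree2 U" for U
  proof -
    obtain W where W: "open W" "U = {T. is_tree T \<and> (\<lambda>\<sigma>. \<sigma> \<in> T) \<in> W}"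
      using U by (auto simp: openin_Tree2)
    then have "F -` U \<inter> space ?M = (\<lambda>y \<sigma>. \<sigma> \<in> F y) -` W \<inter> space ?M"
      using tree space by auto
    then show ?thesis
      using measurable_sets[OF meas, of W] W(1) by simp
  qed
  then show ?thesis
    unfolding Borel_map_def
    by (intro measurable_sigma_sets[OF sets_measure_of[OF sub] sub])
       (auto simp: space tree topspace_Tree2)
qed

section \<open>Analyticity: coding Silver trees by sequences of naturals\<close>

text \<open>\<open>f 0\<close> is the least element, and \<open>f (Suc i)\<close> counts the numbers
  skipped between consecutive elements. Thus every sequence codes an infinite set, and each infinite
  set has a code.\<close>

definition gap_coded_set :: "(nat \<Rightarrow> nat) \<Rightarrow> nat set" where
  "gap_coded_set f = range (\<lambda>k. k + (\<Sum>i\<le>k. f i))"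

lemma infinite_gap_coded_set: "infinite (gap_coded_set f)"
proof -
  have "strict_mono (\<lambda>k. k + (\<Sum>i\<le>k. f i))"
    by (rule strict_monoI_Suc) simp
  then show ?thesis
    by (simp add: gap_coded_set_def range_inj_infinite strict_mono_imp_inj_on)
qed

text \<open>The element with index \<open>k\<close> is at least \<open>k\<close>, so only indices
  \<open>k \<le> n\<close> can produce \<open>n\<close>.\<close>

lemma gap_coded_set_cong:
  assumes "\<forall>i\<le>n. f i = g i"
  shows "n \<in> gap_coded_set f \<longleftrightarrow> n \<in> gap_coded_set g"
proof -
  have "k + (\<Sum>i\<le>k. f i) = n \<longleftrightarrow> k + (\<Sum>i\<le>k. g i) = n" for k
  proof (cases "k \<le> n")
    case True
    then have "(\<Sum>i\<le>k. f i) = (\<Sum>i\<le>k. g i)"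
      using assms by (intro sum.cong) auto
    then show ?thesis by simp
  qed auto
  then show ?thesis
    unfolding gap_coded_set_def by (metis (no_types, lifting) imageE rangeI)
qed

lemma gap_coded_set_surj:
  assumes "infinite B"
  obtains f where "gap_coded_set f = B"
proof -
  define f where "f i = (case i of 0 \<Rightarrow> enumerate B 0
    | Suc j \<Rightarrow> enumerate B (Suc j) - Suc (enumerate B j))" for i
  have "k + (\<Sum>i\<le>k. f i) = enumerate B k" for k
  proof (induction k)
    case (Suc k)
    have "enumerate B k < enumerate B (Suc k)"
      using assms by (rule enumerate_step)
    with Suc show ?case
      by (simp add: f_def)
  qed (simp add: f_def)
  then have "gap_coded_set f = B"
    using range_enumerate[OF assms] by (simp add: gap_coded_set_def)
  then show ?thesis ..
qed

text \<open>Here \<open>B\<close> is the set of free positions, the complement of the set \<open>A\<close> in the definition of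
  Silver trees.\<close>

definition silver :: "nat set \<Rightarrow> (nat \<Rightarrow> bool) \<Rightarrow> bool list set" where
  "silver B x = {\<sigma>. \<forall>n<length \<sigma>. n \<notin> B \<longrightarrow> \<sigma> ! n = x n}"

lemma is_tree_silver: "is_tree (silver B x)"
  unfolding is_tree_def silver_def prefix_def
  by clarsimp (metis nth_append trans_less_add1)

lemma Silver_tree_iff: "Silver_tree S \<longleftrightarrow> (\<exists>B x. infinite B \<and> S = silver B x)"
proof
  assume "Silver_tree S"
  then obtain A x where "infinite (UNIV - A)" "S = silver (UNIV - A) x"
    by (auto simp: Silver_tree_def silver_def)
  then show "\<exists>B x. infinite B \<and> S = silver B x" by blast
next
  assume "\<exists>B x. infinite B \<and> S = silver B x"
  then obtain B x where "infinite B" "S = silver B x" by blast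
  then show "Silver_tree S"
    using is_tree_silver[of B x] unfolding Silver_tree_def
    by (intro conjI exI[of _ "UNIV - B"] exI[of _ x]) (auto simp: silver_def double_diff)
qed

text \<open>Three sequences are interleaved by residue mod 3: free positions, \<open>x\<close>, and
  marks on nodes. Requiring marks on all prefixes yields a tree for every \<open>f\<close>.\<close>

definition silver_param :: "(nat \<Rightarrow> nat) \<Rightarrow> bool list set" where
  "silver_param f = silver (gap_coded_set (\<lambda>i. f (3 * i))) (\<lambda>n. odd (f (3 * n + 1))) \<union>
     {\<tau>. \<forall>\<sigma>. prefix \<sigma> \<tau> \<longrightarrow> 0 < f (3 * to_nat \<sigma> + 2)}"

lemma is_tree_silver_param: "is_tree (silver_param f)"
  using is_tree_silver unfolding silver_param_def is_tree_def
  by (blast intro: prefix_order.trans)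

lemma continuous_silver_param: "continuous_map euclidean Tree2 silver_param"
proof (rule continuous_map_into_Tree2[OF is_tree_silver_param])
  fix \<tau> :: "bool list"
  \<comment> \<open>The entries of \<open>f\<close> that decide \<tau>: the first two streams below
    the length of \<tau>, and the marks of its prefixes.\<close>
  let ?I = "{..3 * length \<tau> + 1} \<union> (\<lambda>\<sigma>. 3 * to_nat \<sigma> + 2) ` set (prefixes \<tau>)"
  show "continuous_on UNIV (\<lambda>f. \<tau> \<in> silver_param f)"
  proof (rule continuous_on_finite_support[of ?I])
    fix f g :: "nat \<Rightarrow> nat"
    assume eq: "\<forall>i\<in>?I. g i = f i"
    then have "n \<in> gap_coded_set (\<lambda>i. g (3 * i)) \<longleftrightarrow> n \<in> gap_coded_set (\<lambda>i. f (3 * i))" if "n < length \<tau>" for n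
      using that by (intro gap_coded_set_cong) auto
    moreover have "g (3 * n + 1) = f (3 * n + 1)" if "n < length \<tau>" for n
      using that eq by simp
    moreover have "g (3 * to_nat \<sigma> + 2) = f (3 * to_nat \<sigma> + 2)" if "prefix \<sigma> \<tau>" for \<sigma>
      using that eq by simp
    ultimately show "(\<tau> \<in> silver_param g) = (\<tau> \<in> silver_param f)"
      by (simp add: silver_param_def silver_def cong: imp_cong)
  qed simp
qed

lemma analytic_Silver: "analytic_in Tree2 {T \<in> topspace Tree2. \<exists>S. Silver_tree S \<and> S \<subseteq> T}"
proof -
  have "silver_param f \<in> {T \<in> topspace Tree2. \<exists>S. Silver_tree S \<and> S \<subseteq> T}" for f
    using infinite_gap_coded_set is_tree_silver_param
    by (auto simp: topspace_Tree2 Silver_tree_iff silver_param_def)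
  moreover have "T \<in> range silver_param" if T: "is_tree T" and S: "Silver_tree S" "S \<subseteq> T" for T S
  proof -
    obtain B x where B: "infinite B" and Bx: "S = silver B x"
      using S(1) Silver_tree_iff by blast
    obtain h where h: "gap_coded_set h = B"
      using gap_coded_set_surj[OF B] .
    \<comment> \<open>The marks pick out exactly the nodes of \<open>T\<close>; since
      \<open>T\<close> is a tree, the subtree part is \<open>T\<close> itself and absorbs
      \<open>S\<close>.\<close>
    define f where "f i = (if i mod 3 = 0 then h (i div 3)
      else if i mod 3 = 1 then of_bool (x (i div 3))
      else of_bool (from_nat (i div 3) \<in> T))" for i
    have "f (3 * i) = h i" "f (3 * i + 1) = of_bool (x i)"
      "f (3 * i + 2) = of_bool (from_nat i \<in> T)" for i
      by (simp_all add: f_def mod_Suc div_Suc)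
    then have "silver_param f = S \<union> {\<tau>. \<forall>\<sigma>. prefix \<sigma> \<tau> \<longrightarrow> \<sigma> \<in> T}"
      by (simp add: silver_param_def h Bx)
    also have "\<dots> = T"
      using T S(2) by (auto simp: is_tree_def)
    finally show ?thesis by blast
  qed
  ultimately have "range silver_param = {T \<in> topspace Tree2. \<exists>S. Silver_tree S \<and> S \<subseteq> T}"
    by (auto simp: topspace_Tree2)
  then show ?thesis
    unfolding analytic_in_def Baire_space_eq using continuous_silver_param by auto
qed

section \<open>Hardness: the reduction and its correctness\<close>

text \<open>The cardinality is the index of \<open>i\<close> in the increasing list of positions of ones in \<open>\<sigma>\<close>.\<close>

definition bounded_by :: "bool list \<Rightarrow> (nat \<Rightarrow> nat) set" where
  "bounded_by \<sigma> = {z. \<forall>i<length \<sigma>. \<sigma> ! i \<longrightarrow> z (card {j. j < i \<and> \<sigma> ! j}) \<le> i}"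

definition reduction :: "'b topology \<Rightarrow> ((nat \<Rightarrow> nat) \<Rightarrow> 'b) \<Rightarrow> 'b \<Rightarrow> bool list set" where
  "reduction Y g y = {\<sigma>. y \<in> Y closure_of (g ` bounded_by \<sigma>)}"

text \<open>The index of a one depends only on earlier entries, so an extension keeps the old bounds
  and may add new ones.\<close>

lemma bounded_by_prefix:
  assumes "prefix \<tau> \<sigma>"
  shows "bounded_by \<sigma> \<subseteq> bounded_by \<tau>"
proof -
  obtain \<rho> where \<sigma>: "\<sigma> = \<tau> @ \<rho>"
    using assms by (auto simp: prefix_def)
  then have "{j. j < i \<and> \<sigma> ! j} = {j. j < i \<and> \<tau> ! j}" "\<sigma> ! i = \<tau> ! i" if "i < length \<tau>" for i
    using that by (auto simp: nth_append)
  then show ?thesis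
    using \<sigma> unfolding bounded_by_def
    by (smt (verit) Collect_mono length_append trans_less_add1)
qed

lemma is_tree_reduction: "is_tree (reduction Y g y)"
proof -
  have "Y closure_of (g ` bounded_by \<sigma>) \<subseteq> Y closure_of (g ` bounded_by \<tau>)" if "prefix \<tau> \<sigma>" for \<sigma> \<tau>
    using that by (intro closure_of_mono image_mono bounded_by_prefix)
  then show ?thesis
    by (auto simp: is_tree_def reduction_def)
qed

lemma silver_subset_reduction:
  assumes g: "continuous_map euclidean Y g"
  obtains B where "infinite B" "silver B (\<lambda>_. False) \<subseteq> reduction Y g (g z)"
proof
  \<comment> \<open>This is the increasing enumeration of \<open>gap_coded_set z\<close>, and it
    dominates \<open>z\<close>.\<close>
  define d where "d k = k + (\<Sum>i\<le>k. z i)" for k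
  have "strict_mono d"
    by (rule strict_monoI_Suc) (simp add: d_def)
  have le: "z k \<le> d k" for k
    unfolding d_def by (intro trans_le_add2 member_le_sum) auto
  show "infinite (gap_coded_set z)"
    by (rule infinite_gap_coded_set)
  show "silver (gap_coded_set z) (\<lambda>_. False) \<subseteq> reduction Y g (g z)"
  proof
    fix \<sigma> assume \<sigma>: "\<sigma> \<in> silver (gap_coded_set z) (\<lambda>_. False)"
    have "z (card {j. j < i \<and> \<sigma> ! j}) \<le> i" if i: "i < length \<sigma>" "\<sigma> ! i" for i
    proof -
      have range: "j \<in> range d" if "j < length \<sigma>" "\<sigma> ! j" for j
        using \<sigma> that by (auto simp: silver_def gap_coded_set_def d_def)
      then obtain m where m: "i = d m"
        using i by blast
      have "{j. j < i \<and> \<sigma> ! j} \<subseteq> d ` {..<m}"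
      proof clarify
        fix j assume j: "j < i" "\<sigma> ! j"
        then obtain l where "j = d l"
          using range[of j] i(1) by auto
        then show "j \<in> d ` {..<m}"
          using j(1) m strict_mono_less[OF \<open>strict_mono d\<close>] by blast
      qed
      then have "card {j. j < i \<and> \<sigma> ! j} \<le> m"
        using surj_card_le[of "{..<m}"] by fastforce
      \<comment> \<open>With \<open>c\<close> the number of earlier ones, \<open>c \<le> m\<close>
        gives \<open>z c \<le> d c \<le> d m = i\<close>.\<close>
      then show ?thesis
        using le m \<open>strict_mono d\<close> by (meson order_trans strict_mono_less_eq)
    qed
    then have "g z \<in> g ` bounded_by \<sigma>"
      by (auto simp: bounded_by_def)
    moreover have "g ` bounded_by \<sigma> \<subseteq> topspace Y"
      using continuous_map_image_subset_topspace[OF g] by auto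
    ultimately show "\<sigma> \<in> reduction Y g (g z)"
      unfolding reduction_def using closure_of_subset by blast
  qed
qed

lemma card_less_enumerate:
  fixes P :: "nat set"
  assumes "infinite P"
  shows "card {j. j < enumerate P k \<and> j \<in> P} = k"
proof -
  have "{j. j < enumerate P k \<and> j \<in> P} = enumerate P ` {..<k}"
    using assms enumerate_Ex[OF assms] by (force intro: enumerate_in_set)
  then show ?thesis
    using assms by (simp add: card_image inj_on_subset[OF inj_enumerate])
qed

lemma silver_subset_reductionD:
  assumes "Hausdorff_space Y" and g: "continuous_map euclidean Y g"
    and B: "infinite B" and sub: "silver B x \<subseteq> reduction Y g y"
  shows "y \<in> range g"
proof -
  \<comment> \<open>The ones of a branch of the Silver tree: every free position is set to 1, every
    other one follows \<open>x\<close>.\<close>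
  define P where "P = B \<union> {n. x n}"
  have P: "infinite P"
    using B by (simp add: P_def)
  define t where "t = enumerate P"
  define \<sigma> where "\<sigma> n = map (\<lambda>i. i \<in> P) [0..<n]" for n
  have "\<sigma> n \<in> silver B x" for n
    by (auto simp: silver_def \<sigma>_def P_def)
  then have y: "y \<in> Y closure_of (g ` bounded_by (\<sigma> n))" for n
    using sub by (auto simp: reduction_def)
  \<comment> \<open>The initial segment of length \<open>t n\<close> has its ones exactly at
    \<open>t 0, ..., t (n - 1)\<close>, and the one at \<open>t i\<close> has index
    \<open>i\<close>.\<close>
  have "bounded_by (\<sigma> (t n)) \<subseteq> {z. \<forall>i<n. z i \<le> t i}" for n
  proof clarify
    fix z i assume z: "z \<in> bounded_by (\<sigma> (t n))" and "i < n"
    then have less: "t i < t n"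
      using P by (simp add: t_def)
    have "{j. j < t i \<and> \<sigma> (t n) ! j} = {j. j < t i \<and> j \<in> P}"
      using less by (auto simp: \<sigma>_def)
    then have "card {j. j < t i \<and> \<sigma> (t n) ! j} = i"
      using card_less_enumerate[OF P] by (simp add: t_def)
    moreover have "\<sigma> (t n) ! t i" "t i < length (\<sigma> (t n))"
      using less enumerate_in_set[OF P] by (simp_all add: \<sigma>_def t_def)
    ultimately show "z i \<le> t i"
      using z unfolding bounded_by_def by fastforce
  qed
  then have "y \<in> Y closure_of (g ` {z. \<forall>i<n. z i \<le> t i})" for n
    using y[of "t n"] by (rule subsetD[OF closure_of_mono[OF image_mono]])
  then have "y \<in> g ` {z. \<forall>i. z i \<le> t i}"
    by (rule mem_image_bounded_functions[OF assms(1) g])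
  then show ?thesis
    by blast
qed

lemma Borel_reducible_Silver:
  fixes Y :: "'b topology"
  assumes "Hausdorff_space Y" "analytic_in Y B"
  shows "Borel_reducible Y B Tree2 {T \<in> topspace Tree2. \<exists>S. Silver_tree S \<and> S \<subseteq> T}"
proof (cases "B = {}")
  case True
  \<comment> \<open>The empty tree contains no Silver tree, because every Silver tree has the node
    \<open>[]\<close>.\<close>
  have "Borel_map Y Tree2 (\<lambda>_. {})"
    by (rule Borel_map_into_Tree2) (auto simp: is_tree_def)
  moreover have "\<not> Silver_tree {}"
    by (auto simp: Silver_tree_iff silver_def set_eq_iff intro: exI[of _ "[]"])
  ultimately show ?thesis
    unfolding Borel_reducible_def using True by auto
next
  case False
  then obtain g :: "(nat \<Rightarrow> nat) \<Rightarrow> 'b" where g: "continuous_map euclidean Y g" "range g = B"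
    using assms(2) unfolding analytic_in_def Baire_space_eq by (metis topspace_euclidean)
  have "Borel_map Y Tree2 (reduction Y g)"
  proof (rule Borel_map_into_Tree2[OF is_tree_reduction])
    fix \<sigma>
    have "{y \<in> topspace Y. \<sigma> \<in> reduction Y g y} = Y closure_of (g ` bounded_by \<sigma>)"
      using closure_of_subset_topspace by (fastforce simp: reduction_def)
    then show "closedin Y {y \<in> topspace Y. \<sigma> \<in> reduction Y g y}"
      by simp
  qed
  moreover have "(\<exists>S. Silver_tree S \<and> S \<subseteq> reduction Y g y) \<longleftrightarrow> y \<in> B" for y
    using silver_subset_reduction[OF g(1)] silver_subset_reductionD[OF assms(1) g(1)] g(2)
    unfolding Silver_tree_iff by (metis rangeE)
  moreover have "B \<subseteq> topspace Y"
    using g continuous_map_image_subset_topspace by fastforce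
  ultimately show ?thesis
    unfolding Borel_reducible_def
    by (intro exI[of _ "reduction Y g"]) (auto simp: topspace_Tree2 is_tree_reduction)
qed

theorem theorem3p9:
  shows "Sigma11_complete TYPE('b) Tree2
           {T \<in> topspace Tree2. \<exists>S. Silver_tree S \<and> S \<subseteq> T}"
  unfolding Sigma11_complete_def
proof (intro conjI allI impI)
  fix Y :: "'b topology" and B
  assume Y: "Polish_top Y \<and> analytic_in Y B"
  then have "Hausdorff_space Y"
    by (simp add: Polish_top_def completely_metrizable_imp_metrizable_space metrizable_imp_Hausdorff_space)
  then show "Borel_reducible Y B Tree2 {T \<in> topspace Tree2. \<exists>S. Silver_tree S \<and> S \<subseteq> T}"
    using Y by (intro Borel_reducible_Silver) auto
qed (rule Polish_top_Tree2, rule analytic_Silver)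

end
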